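(* Let $A\in\mathbb{C}_2^{n\times n}$ be a bicomplex matrix with $\det(A)\notin O_2$. Then $\rho_r(A)=\rho_c(A)=n$.
   Context: $\mathbb{C}_1$ denotes the complex numbers (imaginary unit $i_1$). $\mathbb{C}_2=\{z_1+i_2z_2: z_1,z_2\in\mathbb{C}_1\}$ is the commutative ring of bicomplex numbers, where $i_1i_2=i_2i_1$, $i_1^2=i_2^2=-1$. $O_2$ is the set of non-invertible elements of $\mathbb{C}_2$ (including $0$). For $A\in\mathbb{C}_2^{n\times m}$, the row rank $\rho_r(A)$ is the dimension over $\mathbb{C}_1$ of the $\mathbb{C}_1$-subspace of $\mathbb{C}_2^m$ spanned (with scalars in $\mathbb{C}_1$) by the rows of $A$, and the column rank $\rho_c(A)$ is the dimension over $\mathbb{C}_1$ of the $\mathbb{C}_1$-subspace of $\mathbb{C}_2^n$ spanned by the columns of $A$. *)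

theory Defs
  imports "HOL-Analysis.Analysis"
begin

text \<open>\<open>Bicomplex z\<^sub>1 z\<^sub>2\<close> stands for \<open>z\<^sub>1 + i\<^sub>2 z\<^sub>2\<close>; the imaginary unit of type \<^typ>\<open>complex\<close> is \<open>i\<^sub>1\<close>.\<close>

datatype bicomplex = Bicomplex (bc_fst: complex) (bc_snd: complex)

lemma bicomplex_eq_iff: "w = v \<longleftrightarrow> bc_fst w = bc_fst v \<and> bc_snd w = bc_snd v"
  by (cases w; cases v) simp

instantiation bicomplex :: comm_ring_1
begin

definition "0 = Bicomplex 0 0"
definition "1 = Bicomplex 1 0"
definition "w + v = Bicomplex (bc_fst w + bc_fst v) (bc_snd w + bc_snd v)"
definition "w - v = Bicomplex (bc_fst w - bc_fst v) (bc_snd w - bc_snd v)"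
definition "- w = Bicomplex (- bc_fst w) (- bc_snd w)"
definition "w * v = Bicomplex (bc_fst w * bc_fst v - bc_snd w * bc_snd v)
                              (bc_fst w * bc_snd v + bc_snd w * bc_fst v)"

lemmas bicomplex_defs =
  zero_bicomplex_def one_bicomplex_def plus_bicomplex_def minus_bicomplex_def
  uminus_bicomplex_def times_bicomplex_def

instance
  by standard (simp_all add: bicomplex_defs bicomplex_eq_iff algebra_simps)

end

definition of_C1 :: "complex \<Rightarrow> bicomplex" where
  "of_C1 z = Bicomplex z 0"

definition i2 :: bicomplex where
  "i2 = Bicomplex 0 1"

lemma of_C1_simps:
  "of_C1 0 = 0" "of_C1 1 = 1"
  "of_C1 (a + b) = of_C1 a + of_C1 b" "of_C1 (a * b) = of_C1 a * of_C1 b"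
  by (simp_all add: of_C1_def bicomplex_defs)

lemma i2_squared: "i2 * i2 = - 1"
  by (simp add: i2_def bicomplex_defs)

lemma Bicomplex_eq: "Bicomplex z\<^sub>1 z\<^sub>2 = of_C1 z\<^sub>1 + i2 * of_C1 z\<^sub>2"
  by (simp add: of_C1_def i2_def bicomplex_defs)

definition O2 :: "bicomplex set" where
  "O2 = {w. \<not> (\<exists>v. w * v = 1)}"

definition scale_C1 :: "complex \<Rightarrow> bicomplex ^ 'n \<Rightarrow> bicomplex ^ 'n" where
  "scale_C1 c v = (\<chi> i. of_C1 c * v $ i)"

global_interpretation C1: vector_space scale_C1
  by standard (simp_all add: scale_C1_def vec_eq_iff of_C1_simps algebra_simps)

text \<open>A matrix with \<open>n\<close> rows and \<open>m\<close> columns has type \<^typ>\<open>bicomplex ^ 'm ^ 'n\<close>.\<close>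

definition bc_row_rank :: "bicomplex ^ 'm ^ 'n \<Rightarrow> nat" where
  "bc_row_rank A = C1.dim (C1.span (rows A))"

definition bc_col_rank :: "bicomplex ^ 'm ^ 'n \<Rightarrow> nat" where
  "bc_col_rank A = C1.dim (C1.span (columns A))"

end

theory Submission
  imports Defs
begin

text \<open>
  If \<open>\<Sum>\<^sub>j c\<^sub>j row\<^sub>j(A) = 0\<close>, then replacing row \<open>k\<close> of \<open>A\<close> by this combination multiplies the
  determinant by \<open>c\<^sub>k\<close> and yields a matrix with a zero row, so \<open>c\<^sub>k det A = 0\<close> in any commutative
  ring. As \<open>det A\<close> is invertible, every \<open>c\<^sub>k\<close> vanishes, so the rows are linearly independent over
  the complex numbers. The columns follow by transposition.
\<close>

lemma det_row_combination_zero: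
  fixes A :: "'a::comm_ring_1 ^ 'n ^ 'n"
  assumes "(\<Sum>j\<in>UNIV. x j *s row j A) = 0"
  shows "x k * det A = 0"
proof -
  \<comment> \<open>For \<open>j \<noteq> k\<close> the matrix left after pulling out
    \<open>x j\<close> has equal rows \<open>j\<close> and \<open>k\<close>.\<close>
  have "det (\<chi> i. if i = k then x j *s row j A else row i A) = (if j = k then x k * det A else 0)" for j
  proof -
    have "det (\<chi> i. if i = k then x j *s row j A else row i A)
        = x j * det (\<chi> i. if i = k then row j A else row i A)"
      by (rule det_row_mul)
    moreover have "(\<chi> i. if i = k then row k A else row i A) = A"
      by (simp add: vec_eq_iff row_def)
    moreover have "det (\<chi> i. if i = k then row j A else row i A) = 0" if "j \<noteq> k"
      using that by (intro det_identical_rows[of j k]) (simp_all add: row_def vec_eq_iff)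
    ultimately show ?thesis by auto
  qed
  then have "x k * det A = (\<Sum>j\<in>UNIV. det (\<chi> i. if i = k then x j *s row j A else row i A))"
    by simp
  also have "\<dots> = det (\<chi> i. if i = k then \<Sum>j\<in>UNIV. x j *s row j A else row i A)"
    by (rule det_linear_row_sum[symmetric]) simp
  also have "\<dots> = 0"
    \<comment> \<open>The zero row is written as \<open>0 *s 0\<close>, so the factor 0 comes out of
      the determinant.\<close>
    using det_row_mul[of k 0 "\<lambda>_. 0" "\<lambda>i. row i A"]
    unfolding assms vector_smult_lzero by simp
  finally show ?thesis .
qed

lemma of_C1_eq_0_iff [simp]: "of_C1 c = 0 \<longleftrightarrow> c = 0"
  by (simp add: of_C1_def zero_bicomplex_def)

lemma scale_C1_eq: "scale_C1 c v = of_C1 c *s v"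
  by (simp add: scale_C1_def vector_scalar_mult_def)

text \<open>Complex scalars act through \<open>of_C1\<close>; cancelling the invertible determinant
  leaves \<open>of_C1 (c k) = 0\<close>.\<close>

lemma row_combination_C1_trivial:
  fixes A :: "bicomplex ^ 'n ^ 'n"
  assumes "det A \<notin> O2" and "(\<Sum>j\<in>UNIV. scale_C1 (c j) (row j A)) = 0"
  shows "c k = 0"
proof -
  obtain v where v: "det A * v = 1"
    using assms(1) by (auto simp: O2_def)
  have "of_C1 (c k) * det A = 0"
    using assms(2) by (intro det_row_combination_zero) (simp add: scale_C1_eq)
  then have "of_C1 (c k) * (det A * v) = 0"
    by (simp add: mult.assoc[symmetric])
  then show ?thesis
    using v by simp
qed

text \<open>Since \<open>rows A\<close> is a set, repeated rows would collapse; injectivity allows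
  both reindexing sums over it and counting it.\<close>

lemma inj_row:
  fixes A :: "bicomplex ^ 'n ^ 'n"
  assumes "det A \<notin> O2"
  shows "inj (\<lambda>i. row i A)"
proof (rule injI, rule ccontr)
  fix i j assume "row i A = row j A" "i \<noteq> j"
  then have "det A = 0" by (rule det_identical_rows[rotated])
  moreover have "(0::bicomplex) \<in> O2" by (simp add: O2_def)
  ultimately show False using assms by simp
qed

lemma independent_rows:
  fixes A :: "bicomplex ^ 'n ^ 'n"
  assumes "det A \<notin> O2"
  shows "C1.independent (rows A)"
proof -
  have rows: "rows A = range (\<lambda>i. row i A)"
    by (auto simp: rows_def)
  have "u (row k A) = 0" if "(\<Sum>v\<in>rows A. scale_C1 (u v) v) = 0" for u k
  \<comment> \<open>Coefficients \<open>u\<close> indexed by vectors become coefficients indexed by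
    row numbers.\<close>
  proof (rule row_combination_C1_trivial[OF assms])
    show "(\<Sum>j\<in>UNIV. scale_C1 (u (row j A)) (row j A)) = 0"
      using that by (simp add: rows sum.reindex[OF inj_row[OF assms]])
  qed
  then show ?thesis
    by (auto simp: C1.dependent_finite rows)
qed

lemma bc_row_rank_eq_CARD:
  fixes A :: "bicomplex ^ 'n ^ 'n"
  assumes "det A \<notin> O2"
  shows "bc_row_rank A = CARD('n)"
proof -
  have "rows A = range (\<lambda>i. row i A)"
    by (auto simp: rows_def)
  then have "card (rows A) = CARD('n)"
    using inj_row[OF assms] by (simp add: card_image)
  then show ?thesis
    by (simp add: bc_row_rank_def C1.dim_eq_card_independent[OF independent_rows[OF assms]])
qed

theorem corollary2p36:
  fixes A :: "bicomplex ^ 'n ^ 'n"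
  assumes "det A \<notin> O2"
  shows "bc_row_rank A = CARD('n) \<and> bc_col_rank A = CARD('n)"
proof
  show "bc_row_rank A = CARD('n)"
    using assms by (rule bc_row_rank_eq_CARD)
  have "bc_col_rank A = bc_row_rank (transpose A)"
    by (simp add: bc_col_rank_def bc_row_rank_def)
  also have "\<dots> = CARD('n)"
    \<comment> \<open>Transposition preserves the determinant, so the hypothesis carries
      over.\<close>
    using assms by (intro bc_row_rank_eq_CARD) simp
  finally show "bc_col_rank A = CARD('n)" .
qed

end
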